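(* There exists a one-parameter family of isosceles trapezoid relative equilibria of the four-vortex problem with vortex strengths $\Gamma_1=\Gamma_2=1$ and $\Gamma_3=\Gamma_4=m$ ($m\in\mathbb{R}\setminus\{0\}$). The vortices 1 and 2 lie on one base of the trapezoid, while 3 and 4 lie on the other. Let $\alpha=m(m+2)/(2m+1)$. If $r_{13}=r_{24}$ are the lengths of the two congruent diagonals (so $r_{14}=r_{23}$ are the legs), then the mutual distances are described by $$\left(\frac{r_{34}}{r_{12}}\right)^2=\alpha,\qquad \left(\frac{r_{14}}{r_{12}}\right)^2=\frac12\left(m+2-\sqrt{\alpha}\right),\qquad \left(\frac{r_{13}}{r_{12}}\right)^2=\frac12\left(m+2+\sqrt{\alpha}\right).$$ This family exists if and only if $m>0$. The case $m=1$ reduces to the square. For $m\neq1$, the larger pair of vortices (those of larger strength) lie on the longest base.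
   Context: Four point vortices have distinct positions $x_i\in\mathbb{R}^2$ and strengths $\Gamma_i\in\mathbb{R}\setminus\{0\}$; $r_{ij}=\|x_i-x_j\|$. The configuration is a relative equilibrium (central configuration) if there are $\lambda\in\mathbb{R}\setminus\{0\}$ and $c\in\mathbb{R}^2$ with $-\lambda(x_i-c)=\sum_{j\ne i}\frac{\Gamma_j}{r_{ij}^2}(x_j-x_i)$ for $i=1,\dots,4$. An isosceles trapezoid here is a (non-collinear) convex quadrilateral with vortices ordered $1,2,3,4$ sequentially around it, with diagonals $r_{13}=r_{24}$, congruent legs $r_{14}=r_{23}$, and parallel bases joining 1,2 and 3,4 (rectangles are allowed). *)

theory Defs
  imports "HOL-Analysis.Analysis"
begin

definition relative_equilibrium :: "(nat \<Rightarrow> real) \<Rightarrow> (nat \<Rightarrow> real ^ 2) \<Rightarrow> bool" where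
  "relative_equilibrium \<Gamma> x \<longleftrightarrow>
     (\<forall>i\<in>{1..4}. \<Gamma> i \<noteq> 0) \<and> inj_on x {1..4} \<and>
     (\<exists>lam c. lam \<noteq> 0 \<and>
        (\<forall>i\<in>{1..4}. - (lam *\<^sub>R (x i - c)) =
           (\<Sum>j\<in>{1..4} - {i}. (\<Gamma> j / (dist (x i) (x j))\<^sup>2) *\<^sub>R (x j - x i))))"

definition strengths :: "real \<Rightarrow> nat \<Rightarrow> real" where
  "strengths m i = (if i \<in> {1, 2} then 1 else m)"

text \<open>Twice the signed area of the triangle \<open>p q r\<close>.\<close>
definition orient :: "real ^ 2 \<Rightarrow> real ^ 2 \<Rightarrow> real ^ 2 \<Rightarrow> real" where
  "orient p q r = (q $ 1 - p $ 1) * (r $ 2 - p $ 2) - (q $ 2 - p $ 2) * (r $ 1 - p $ 1)"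

definition strictly_same_side :: "real ^ 2 \<Rightarrow> real ^ 2 \<Rightarrow> real ^ 2 \<Rightarrow> real ^ 2 \<Rightarrow> bool" where
  "strictly_same_side p q r s \<longleftrightarrow> orient p q r * orient p q s > 0"

text \<open>The vertices are listed in order around the quadrilateral, in either orientation: the
  line through each side has the other two vertices strictly on one side. In particular no
  three vertices are collinear.\<close>
definition convex_quadrilateral :: "real ^ 2 \<Rightarrow> real ^ 2 \<Rightarrow> real ^ 2 \<Rightarrow> real ^ 2 \<Rightarrow> bool" where
  "convex_quadrilateral p q r s \<longleftrightarrow>
     strictly_same_side p q r s \<and> strictly_same_side q r s p \<and>
     strictly_same_side r s p q \<and> strictly_same_side s p q r"

text \<open>The bases are \<open>p q\<close> and \<open>r s\<close>; rectangles are included.\<close>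
definition isosceles_trapezoid :: "real ^ 2 \<Rightarrow> real ^ 2 \<Rightarrow> real ^ 2 \<Rightarrow> real ^ 2 \<Rightarrow> bool" where
  "isosceles_trapezoid p q r s \<longleftrightarrow>
     convex_quadrilateral p q r s \<and>
     (\<exists>t. s - r = t *\<^sub>R (q - p)) \<and>
     dist p r = dist q s \<and> dist p s = dist q r"

definition is_square :: "real ^ 2 \<Rightarrow> real ^ 2 \<Rightarrow> real ^ 2 \<Rightarrow> real ^ 2 \<Rightarrow> bool" where
  "is_square p q r s \<longleftrightarrow>
     convex_quadrilateral p q r s \<and>
     dist p q = dist q r \<and> dist q r = dist r s \<and> dist r s = dist s p \<and>
     orthogonal (q - p) (s - p) \<and> orthogonal (r - q) (p - q) \<and>
     orthogonal (s - r) (q - r) \<and> orthogonal (p - s) (r - s)"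

definition trapezoid_equilibrium :: "real \<Rightarrow> (nat \<Rightarrow> real ^ 2) \<Rightarrow> bool" where
  "trapezoid_equilibrium m x \<longleftrightarrow>
     isosceles_trapezoid (x 1) (x 2) (x 3) (x 4) \<and> relative_equilibrium (strengths m) x"

end

theory Submission
  imports Defs
begin

text \<open>
  An isosceles trapezoid is symmetric about the perpendicular bisector of its bases. Let \<open>e\<close> be
  the base vector from vortex 1 to vortex 2, \<open>n \<bottom> e\<close> the vector from the midpoint of that base to
  the midpoint of the other one, and \<open>u\<close> the ratio of the base lengths. All four
  equilibrium equations then lie in the span of the independent vectors \<open>e\<close> and \<open>n\<close>, so that
  comparing coefficients turns them into scalar equations
  (\<open>relative_equilibrium_trapezoid_iff\<close>). The components along \<open>n\<close> determine the multiplier;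
  as it is a positive multiple of \<open>1 + m\<close>, they also exclude \<open>m = -1\<close>.
  Two equations along \<open>e\<close> remain. In units of the squared base \<open>|e|\<^sup>2\<close>, with squared diagonal \<open>D\<close>
  and squared leg \<open>L\<close>, they are
  \<open>2 = (1 - m u)/D + (1 + m u)/L\<close> and \<open>2 m/u = (m u - 1)/D + (m u + 1)/L\<close>.

  Ptolemy's relation \<open>D - L = u\<close> leaves the unknowns \<open>u\<^sup>2\<close> and \<open>S = D + L\<close>. Eliminating \<open>u\<^sup>2\<close>
  gives the quadratic \<open>(S - (m + 2)) (m S + 1) = 0\<close>. The root \<open>S = -1/m\<close> would force \<open>S = u\<close>, hence
  \<open>L = 0\<close>: vortices 1 and 4 would collide. So \<open>S = m + 2\<close> and \<open>u\<^sup>2 = m (m + 2)/(2 m + 1)\<close>, and then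
  \<open>L > 0\<close> is possible for \<open>m > 0\<close> only (\<open>scalar_equations_iff\<close>). Conversely every trapezoid with
  these values is an equilibrium, and for \<open>m > 0\<close> a height realising them exists, because the squared
  height comes out as \<open>3 (m + 1)\<^sup>2 / (4 (2 m + 1))\<close>. The comparison of the bases follows from
  \<open>u\<^sup>2 - 1 = (m - 1) (m + 1)/(2 m + 1)\<close>.
\<close>

section \<open>Isosceles trapezoids in a symmetric frame\<close>

text \<open>The base midpoint \<open>a\<close> rather than a vertex serves as origin, which keeps the reflection
  symmetry visible: it is \<open>e \<mapsto> - e\<close>. The other base is \<open>u\<close> times as long.\<close>

definition trapezoid_vertex ::
    "real ^ 2 \<Rightarrow> real ^ 2 \<Rightarrow> real ^ 2 \<Rightarrow> real \<Rightarrow> nat \<Rightarrow> real ^ 2" where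
  "trapezoid_vertex a e n u i =
     (if i = 1 then a - (1 / 2) *\<^sub>R e
      else if i = 2 then a + (1 / 2) *\<^sub>R e
      else if i = 3 then a + n + (u / 2) *\<^sub>R e
      else a + n - (u / 2) *\<^sub>R e)"

definition trapezoid_frame :: "real ^ 2 \<Rightarrow> real ^ 2 \<Rightarrow> real \<Rightarrow> bool" where
  "trapezoid_frame e n u \<longleftrightarrow> e \<noteq> 0 \<and> n \<noteq> 0 \<and> u > 0 \<and> e \<bullet> n = 0"

lemma inner_real2: "(v :: real ^ 2) \<bullet> w = v $ 1 * w $ 1 + v $ 2 * w $ 2"
  by (simp add: inner_vec_def sum_2)

text \<open>Lagrange's identity for orthogonal vectors; it makes the frame vectors span a
  nondegenerate trapezoid.\<close>

lemma orient_squared_orthogonal: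
  fixes e n :: "real ^ 2"
  assumes "e \<bullet> n = 0"
  shows "(orient 0 e n)\<^sup>2 = (e \<bullet> e) * (n \<bullet> n)"
proof -
  have "(orient 0 e n)\<^sup>2 = (e \<bullet> e) * (n \<bullet> n) - (e \<bullet> n)\<^sup>2"
    by (simp add: orient_def inner_real2 power2_eq_square algebra_simps)
  then show ?thesis using assms by simp
qed

text \<open>Parallel bases alone give a frame with \<open>u\<close> of either sign and \<open>n\<close> oblique. Convexity forces
  \<open>u > 0\<close>, since the legs cross for \<open>u < 0\<close>, and the diagonals differ in squared length by
  \<open>2 (u + 1) (e \<bullet> n)\<close>, so that their equality makes \<open>n\<close> perpendicular to the bases.\<close>

lemma isosceles_trapezoid_in_frame:
  assumes "isosceles_trapezoid (x 1) (x 2) (x 3) (x 4)"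
  obtains a e n u where "trapezoid_frame e n u"
    and "\<forall>i\<in>{1..4}. x i = trapezoid_vertex a e n u i"
proof -
  obtain t where t: "x 4 - x 3 = t *\<^sub>R (x 2 - x 1)"
    and diag: "dist (x 1) (x 3) = dist (x 2) (x 4)"
    and cvx: "convex_quadrilateral (x 1) (x 2) (x 3) (x 4)"
    using assms unfolding isosceles_trapezoid_def by auto
  define e where "e = x 2 - x 1"
  define a where "a = (1 / 2) *\<^sub>R (x 1 + x 2)"
  define n where "n = (1 / 2) *\<^sub>R (x 3 + x 4) - a"
  define u where "u = - t"
  have c4: "x 4 $ k = x 3 $ k + t * (x 2 $ k - x 1 $ k)" for k
    using arg_cong[OF t, of "\<lambda>v. v $ k"] by simp
  have v: "x 1 = a - (1 / 2) *\<^sub>R e" "x 2 = a + (1 / 2) *\<^sub>R e"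
    "x 3 = a + n + (u / 2) *\<^sub>R e" "x 4 = a + n - (u / 2) *\<^sub>R e"
    by (simp_all add: vec_eq_iff a_def e_def n_def u_def c4 field_simps)
  have o1: "orient (x 1) (x 2) (x 3) = orient 0 e n"
    unfolding v by (simp add: orient_def algebra_simps)
  have ne: "orient 0 e n \<noteq> 0"
    using cvx o1 by (auto simp: convex_quadrilateral_def strictly_same_side_def)
  have "e \<noteq> 0" "n \<noteq> 0" using ne by (auto simp: orient_def)
  have "orient (x 2) (x 3) (x 4) * orient (x 2) (x 3) (x 1) = u * (orient 0 e n)\<^sup>2"
    unfolding v by (simp add: orient_def algebra_simps power2_eq_square)
  then have "u * (orient 0 e n)\<^sup>2 > 0"
    using cvx by (simp add: convex_quadrilateral_def strictly_same_side_def)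
  then have "u > 0" by (simp add: zero_less_mult_iff)
  have "(dist (x 1) (x 3))\<^sup>2 - (dist (x 2) (x 4))\<^sup>2 = 2 * (u + 1) * (e \<bullet> n)"
    unfolding v dist_norm power2_norm_eq_inner
    by (simp add: inner_real2 field_simps)
  then have "e \<bullet> n = 0" using diag \<open>u > 0\<close> by simp
  show thesis
  proof
    show "trapezoid_frame e n u"
      using \<open>e \<noteq> 0\<close> \<open>n \<noteq> 0\<close> \<open>u > 0\<close> \<open>e \<bullet> n = 0\<close>
      by (simp add: trapezoid_frame_def)
    have "{1..4} = {1, 2, 3, 4 :: nat}" by auto
    then show "\<forall>i\<in>{1..4}. x i = trapezoid_vertex a e n u i"
      using v by (simp add: trapezoid_vertex_def)
  qed
qed

lemma trapezoid_vertex_simps: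
  "trapezoid_vertex a e n u 1 = a - (1 / 2) *\<^sub>R e"
  "trapezoid_vertex a e n u (Suc 0) = a - (1 / 2) *\<^sub>R e"
  "trapezoid_vertex a e n u 2 = a + (1 / 2) *\<^sub>R e"
  "trapezoid_vertex a e n u 3 = a + n + (u / 2) *\<^sub>R e"
  "trapezoid_vertex a e n u 4 = a + n - (u / 2) *\<^sub>R e"
  by (simp_all add: trapezoid_vertex_def)

text \<open>Squared leg and squared diagonal in units of the squared base \<open>e \<bullet> e\<close>.\<close>

definition leg_ratio :: "real ^ 2 \<Rightarrow> real ^ 2 \<Rightarrow> real \<Rightarrow> real" where
  "leg_ratio e n u = (n \<bullet> n) / (e \<bullet> e) + ((1 - u) / 2)\<^sup>2"

definition diag_ratio :: "real ^ 2 \<Rightarrow> real ^ 2 \<Rightarrow> real \<Rightarrow> real" where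
  "diag_ratio e n u = (n \<bullet> n) / (e \<bullet> e) + ((1 + u) / 2)\<^sup>2"

text \<open>Ptolemy's theorem: the trapezoid is cyclic, so the squared diagonal exceeds the squared leg by
  the product of the bases.\<close>

lemma diag_ratio_eq: "diag_ratio e n u = leg_ratio e n u + u"
  by (simp add: leg_ratio_def diag_ratio_def power2_eq_square field_simps)

lemma leg_ratio_pos: "trapezoid_frame e n u \<Longrightarrow> leg_ratio e n u > 0"
  unfolding trapezoid_frame_def leg_ratio_def
  by (intro add_pos_nonneg divide_pos_pos) auto

lemma trapezoid_distances:
  fixes a :: "real ^ 2"
  assumes "trapezoid_frame e n u"
  defines "v \<equiv> trapezoid_vertex a e n u"
  shows "(dist (v 1) (v 2))\<^sup>2 = e \<bullet> e" "(dist (v 3) (v 4))\<^sup>2 = u\<^sup>2 * (e \<bullet> e)"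
    "(dist (v 1) (v 4))\<^sup>2 = leg_ratio e n u * (e \<bullet> e)"
    "(dist (v 2) (v 3))\<^sup>2 = leg_ratio e n u * (e \<bullet> e)"
    "(dist (v 1) (v 3))\<^sup>2 = diag_ratio e n u * (e \<bullet> e)"
    "(dist (v 2) (v 4))\<^sup>2 = diag_ratio e n u * (e \<bullet> e)"
proof -
  have on: "e \<bullet> n = 0" and "e \<bullet> e \<noteq> 0" using assms by (auto simp: trapezoid_frame_def)
  have L: "leg_ratio e n u * (e \<bullet> e) = n \<bullet> n + ((1 - u) / 2)\<^sup>2 * (e \<bullet> e)"
    using \<open>e \<bullet> e \<noteq> 0\<close> by (simp add: leg_ratio_def distrib_right)
  have D: "diag_ratio e n u * (e \<bullet> e) = n \<bullet> n + ((1 + u) / 2)\<^sup>2 * (e \<bullet> e)"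
    using \<open>e \<bullet> e \<noteq> 0\<close> by (simp add: diag_ratio_def distrib_right)
  have pyth: "(norm (s *\<^sub>R n + t *\<^sub>R e))\<^sup>2 = s\<^sup>2 * (n \<bullet> n) + t\<^sup>2 * (e \<bullet> e)" for s t
    using on unfolding power2_norm_eq_inner
    by (simp add: inner_add inner_commute[of n e] power2_eq_square)
  have d: "v 1 - v 2 = 0 *\<^sub>R n + (-1) *\<^sub>R e" "v 3 - v 4 = 0 *\<^sub>R n + u *\<^sub>R e"
    "v 1 - v 4 = (-1) *\<^sub>R n + (- ((1 - u) / 2)) *\<^sub>R e"
    "v 2 - v 3 = (-1) *\<^sub>R n + ((1 - u) / 2) *\<^sub>R e"
    "v 1 - v 3 = (-1) *\<^sub>R n + (- ((1 + u) / 2)) *\<^sub>R e"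
    "v 2 - v 4 = (-1) *\<^sub>R n + ((1 + u) / 2) *\<^sub>R e"
    by (simp_all add: v_def trapezoid_vertex_simps vec_eq_iff field_simps)
  show "(dist (v 1) (v 2))\<^sup>2 = e \<bullet> e" "(dist (v 3) (v 4))\<^sup>2 = u\<^sup>2 * (e \<bullet> e)"
    "(dist (v 1) (v 4))\<^sup>2 = leg_ratio e n u * (e \<bullet> e)"
    "(dist (v 2) (v 3))\<^sup>2 = leg_ratio e n u * (e \<bullet> e)"
    "(dist (v 1) (v 3))\<^sup>2 = diag_ratio e n u * (e \<bullet> e)"
    "(dist (v 2) (v 4))\<^sup>2 = diag_ratio e n u * (e \<bullet> e)"
    unfolding dist_norm d pyth L D by simp_all
qed

text \<open>Conversely, every frame gives an isosceles trapezoid: all orientation products in the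
  definition of convexity are positive multiples of \<open>(orient 0 e n)\<^sup>2\<close>.\<close>

lemma trapezoid_vertex_isosceles_trapezoid:
  fixes a :: "real ^ 2"
  assumes fr: "trapezoid_frame e n u"
  defines "v \<equiv> trapezoid_vertex a e n u"
  shows "isosceles_trapezoid (v 1) (v 2) (v 3) (v 4)"
proof -
  have "u > 0" "(orient 0 e n)\<^sup>2 > 0"
    using fr orient_squared_orthogonal[of e n] by (auto simp: trapezoid_frame_def)
  moreover have "orient (v 1) (v 2) (v 3) * orient (v 1) (v 2) (v 4) = (orient 0 e n)\<^sup>2"
    "orient (v 2) (v 3) (v 4) * orient (v 2) (v 3) (v 1) = u * (orient 0 e n)\<^sup>2"
    "orient (v 3) (v 4) (v 1) * orient (v 3) (v 4) (v 2) = u\<^sup>2 * (orient 0 e n)\<^sup>2"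
    "orient (v 4) (v 1) (v 2) * orient (v 4) (v 1) (v 3) = u * (orient 0 e n)\<^sup>2"
    by (simp_all add: v_def trapezoid_vertex_simps orient_def power2_eq_square field_simps)
  ultimately have "convex_quadrilateral (v 1) (v 2) (v 3) (v 4)"
    by (simp add: convex_quadrilateral_def strictly_same_side_def)
  moreover have "v 4 - v 3 = (- u) *\<^sub>R (v 2 - v 1)"
    by (simp add: v_def trapezoid_vertex_simps vec_eq_iff field_simps)
  moreover have "dist (v 1) (v 3) = dist (v 2) (v 4)" "dist (v 1) (v 4) = dist (v 2) (v 3)"
    using trapezoid_distances[OF fr, of a] unfolding v_def
    by (auto simp flip: power2_eq_iff_nonneg[of "dist _ _" "dist _ _"])
  ultimately show ?thesis unfolding isosceles_trapezoid_def by blast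
qed

section \<open>Reduction of the equilibrium equations to two scalar equations\<close>

lemma relative_equilibrium_iff_four_equations:
  assumes "m \<noteq> 0" "inj_on x {1..4}"
  shows "relative_equilibrium (strengths m) x \<longleftrightarrow> (\<exists>lam c. lam \<noteq> 0 \<and>
    - (lam *\<^sub>R (x 1 - c)) = (1 / (dist (x 1) (x 2))\<^sup>2) *\<^sub>R (x 2 - x 1)
      + (m / (dist (x 1) (x 3))\<^sup>2) *\<^sub>R (x 3 - x 1) + (m / (dist (x 1) (x 4))\<^sup>2) *\<^sub>R (x 4 - x 1) \<and>
    - (lam *\<^sub>R (x 2 - c)) = (1 / (dist (x 1) (x 2))\<^sup>2) *\<^sub>R (x 1 - x 2)
      + (m / (dist (x 2) (x 3))\<^sup>2) *\<^sub>R (x 3 - x 2) + (m / (dist (x 2) (x 4))\<^sup>2) *\<^sub>R (x 4 - x 2) \<and>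
    - (lam *\<^sub>R (x 3 - c)) = (1 / (dist (x 1) (x 3))\<^sup>2) *\<^sub>R (x 1 - x 3)
      + (1 / (dist (x 2) (x 3))\<^sup>2) *\<^sub>R (x 2 - x 3) + (m / (dist (x 3) (x 4))\<^sup>2) *\<^sub>R (x 4 - x 3) \<and>
    - (lam *\<^sub>R (x 4 - c)) = (1 / (dist (x 1) (x 4))\<^sup>2) *\<^sub>R (x 1 - x 4)
      + (1 / (dist (x 2) (x 4))\<^sup>2) *\<^sub>R (x 2 - x 4) + (m / (dist (x 3) (x 4))\<^sup>2) *\<^sub>R (x 3 - x 4))"
proof -
  have I: "{1..4} = {1, 2, 3, 4 :: nat}" by auto
  have "{1, 2, 3, 4} - {1} = {2, 3, 4 :: nat}" "{1, 2, 3, 4} - {2} = {1, 3, 4 :: nat}"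
    "{1, 2, 3, 4} - {3} = {1, 2, 4 :: nat}" "{1, 2, 3, 4} - {4} = {1, 2, 3 :: nat}"
    by auto
  then show ?thesis
    using assms unfolding relative_equilibrium_def I
    by (simp add: strengths_def dist_commute add.assoc)
qed

lemma relative_equilibrium_cong:
  assumes "\<forall>i\<in>{1..4}. x i = y i"
  shows "relative_equilibrium \<Gamma> x \<longleftrightarrow> relative_equilibrium \<Gamma> y"
proof -
  have "inj_on x {1..4} \<longleftrightarrow> inj_on y {1..4}"
    using assms by (intro inj_on_cong) auto
  moreover have "(\<Sum>j\<in>{1..4} - {i}. (\<Gamma> j / (dist (x i) (x j))\<^sup>2) *\<^sub>R (x j - x i)) =
      (\<Sum>j\<in>{1..4} - {i}. (\<Gamma> j / (dist (y i) (y j))\<^sup>2) *\<^sub>R (y j - y i))"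
    if "i \<in> {1..4}" for i
    by (rule sum.cong) (use assms that in auto)
  ultimately show ?thesis
    unfolding relative_equilibrium_def using assms by simp
qed

lemma orthogonal_combination_eq_0_iff:
  fixes e n :: "'a :: real_inner"
  assumes "e \<noteq> 0" "n \<noteq> 0" "e \<bullet> n = 0"
  shows "s *\<^sub>R e + t *\<^sub>R n = 0 \<longleftrightarrow> s = 0 \<and> t = 0"
proof
  assume z: "s *\<^sub>R e + t *\<^sub>R n = 0"
  have "(s *\<^sub>R e + t *\<^sub>R n) \<bullet> e = s * (e \<bullet> e)" "(s *\<^sub>R e + t *\<^sub>R n) \<bullet> n = t * (n \<bullet> n)"
    using assms(3) by (simp_all add: inner_add inner_commute[of n e])
  then show "s = 0 \<and> t = 0" using z assms(1,2) by simp
qed simp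

lemma trapezoid_vertex_inj_on:
  assumes "trapezoid_frame e n u"
  shows "inj_on (trapezoid_vertex a e n u) {1..4}"
proof -
  let ?v = "trapezoid_vertex a e n u"
  have pos: "e \<bullet> e > 0" "u > 0" "leg_ratio e n u > 0" "diag_ratio e n u > 0"
    using assms leg_ratio_pos[OF assms] by (auto simp: trapezoid_frame_def diag_ratio_eq)
  have ne: "?v 1 \<noteq> ?v 2" "?v 3 \<noteq> ?v 4" "?v 1 \<noteq> ?v 4" "?v 2 \<noteq> ?v 3" "?v 1 \<noteq> ?v 3" "?v 2 \<noteq> ?v 4"
    using trapezoid_distances[OF assms, of a] pos by force+
  have I: "{1..4} = {1, 2, 3, 4 :: nat}" by auto
  show ?thesis unfolding I inj_on_insert using ne by auto
qed

text \<open>The equilibrium equations after multiplication by \<open>e \<bullet> e\<close>, with \<open>p = 1/D\<close>, \<open>q = 1/L\<close> and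
  \<open>w = m/u\<close> as free parameters, which makes them polynomial. Adding the equations of vertices 1 and 2
  and subtracting those of 3 and 4 cancels \<open>a\<close>, \<open>c\<close> and \<open>e\<close> and leaves the value of \<open>\<kappa>\<close>; the
  differences within each base give the two equations along \<open>e\<close>. In the other direction the centre
  is the centre of vorticity \<open>a + (m / (1 + m)) n\<close>.\<close>

lemma symmetric_vertex_equations_iff:
  fixes a e n :: "real ^ 2" and m u w p q :: real
  assumes "e \<noteq> 0" "n \<noteq> 0" "e \<bullet> n = 0" "p > 0" "q > 0"
  shows "(\<exists>\<kappa> c. \<kappa> \<noteq> 0 \<and>
    - (\<kappa> *\<^sub>R (a - (1 / 2) *\<^sub>R e - c)) = e
      + (m * p) *\<^sub>R (n + ((1 + u) / 2) *\<^sub>R e) + (m * q) *\<^sub>R (n + ((1 - u) / 2) *\<^sub>R e) \<and>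
    - (\<kappa> *\<^sub>R (a + (1 / 2) *\<^sub>R e - c)) = - e
      + (m * q) *\<^sub>R (n - ((1 - u) / 2) *\<^sub>R e) + (m * p) *\<^sub>R (n - ((1 + u) / 2) *\<^sub>R e) \<and>
    - (\<kappa> *\<^sub>R (a + n + (u / 2) *\<^sub>R e - c)) = - (w *\<^sub>R e)
      - p *\<^sub>R (n + ((1 + u) / 2) *\<^sub>R e) - q *\<^sub>R (n - ((1 - u) / 2) *\<^sub>R e) \<and>
    - (\<kappa> *\<^sub>R (a + n - (u / 2) *\<^sub>R e - c)) = w *\<^sub>R e
      - q *\<^sub>R (n + ((1 - u) / 2) *\<^sub>R e) - p *\<^sub>R (n - ((1 + u) / 2) *\<^sub>R e)) \<longleftrightarrow>
    m \<noteq> - 1 \<and> 2 = (1 - m * u) * p + (1 + m * u) * q \<and>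
    2 * w = (m * u - 1) * p + (m * u + 1) * q"
    (is "(\<exists>\<kappa> c. \<kappa> \<noteq> 0 \<and> ?l1 \<kappa> c = ?r1 \<and> ?l2 \<kappa> c = ?r2 \<and> ?l3 \<kappa> c = ?r3 \<and> ?l4 \<kappa> c = ?r4) \<longleftrightarrow> ?scalar")
proof
  have zero: "s *\<^sub>R e + t *\<^sub>R n = 0 \<longleftrightarrow> s = 0 \<and> t = 0" for s t
    using orthogonal_combination_eq_0_iff[OF assms(1-3)] .
  assume "\<exists>\<kappa> c. \<kappa> \<noteq> 0 \<and> ?l1 \<kappa> c = ?r1 \<and> ?l2 \<kappa> c = ?r2 \<and> ?l3 \<kappa> c = ?r3 \<and> ?l4 \<kappa> c = ?r4"
  then obtain \<kappa> c where "\<kappa> \<noteq> 0"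
    and F: "?l1 \<kappa> c - ?r1 = 0" "?l2 \<kappa> c - ?r2 = 0" "?l3 \<kappa> c - ?r3 = 0" "?l4 \<kappa> c - ?r4 = 0"
    by auto
  have "0 *\<^sub>R e + (2 * \<kappa> - 2 * (1 + m) * (p + q)) *\<^sub>R n =
      (?l1 \<kappa> c - ?r1) + (?l2 \<kappa> c - ?r2) - (?l3 \<kappa> c - ?r3) - (?l4 \<kappa> c - ?r4)"
    by (simp add: vec_eq_iff field_simps)
  then have sum: "\<kappa> = (1 + m) * (p + q)"
    using zero[of 0 "2 * \<kappa> - 2 * (1 + m) * (p + q)"] unfolding F by (simp add: algebra_simps)
  have "(\<kappa> - 2 - m * (p * (1 + u) + q * (1 - u))) *\<^sub>R e + 0 *\<^sub>R n =
      (?l1 \<kappa> c - ?r1) - (?l2 \<kappa> c - ?r2)"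
    by (simp add: vec_eq_iff field_simps)
  then have e12: "\<kappa> = 2 + m * (p * (1 + u) + q * (1 - u))"
    using zero[of "\<kappa> - 2 - m * (p * (1 + u) + q * (1 - u))" 0] unfolding F by auto
  have "(\<kappa> * u - 2 * w - (p * (1 + u) - q * (1 - u))) *\<^sub>R e + 0 *\<^sub>R n =
      (?l4 \<kappa> c - ?r4) - (?l3 \<kappa> c - ?r3)"
    by (simp add: vec_eq_iff field_simps)
  then have e34: "\<kappa> * u = 2 * w + (p * (1 + u) - q * (1 - u))"
    using zero[of "\<kappa> * u - 2 * w - (p * (1 + u) - q * (1 - u))" 0] unfolding F by auto
  have "m \<noteq> - 1" using sum \<open>\<kappa> \<noteq> 0\<close> by auto
  moreover have "2 = (1 - m * u) * p + (1 + m * u) * q"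
    using e12 unfolding sum by (simp add: algebra_simps)
  moreover have "2 * w = (m * u - 1) * p + (m * u + 1) * q"
    using e34 unfolding sum by (simp add: algebra_simps)
  ultimately show ?scalar by blast
next
  assume sc: ?scalar
  define \<kappa> where "\<kappa> = (1 + m) * (p + q)"
  define c where "c = a + (m / (1 + m)) *\<^sub>R n"
  have "m \<noteq> - 1" and s1: "(1 - m * u) * p + (1 + m * u) * q - 2 = 0"
    and s2: "(m * u - 1) * p + (m * u + 1) * q - 2 * w = 0" using sc by auto
  have "1 + m \<noteq> 0" using \<open>m \<noteq> - 1\<close> by linarith
  then have kc: "\<kappa> *\<^sub>R c = \<kappa> *\<^sub>R a + (m * (p + q)) *\<^sub>R n"
    by (simp add: \<kappa>_def c_def scaleR_add_right)
  have "?l1 \<kappa> c - ?r1 = ((1 - m * u) * p + (1 + m * u) * q - 2) *\<^sub>R ((1 / 2) *\<^sub>R e)"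
    "?l2 \<kappa> c - ?r2 = ((1 - m * u) * p + (1 + m * u) * q - 2) *\<^sub>R (- (1 / 2) *\<^sub>R e)"
    "?l3 \<kappa> c - ?r3 = ((m * u - 1) * p + (m * u + 1) * q - 2 * w) *\<^sub>R (- (1 / 2) *\<^sub>R e)"
    "?l4 \<kappa> c - ?r4 = ((m * u - 1) * p + (m * u + 1) * q - 2 * w) *\<^sub>R ((1 / 2) *\<^sub>R e)"
    unfolding scaleR_diff_right kc
    by (simp_all add: \<kappa>_def vec_eq_iff field_simps)
  then have "?l1 \<kappa> c = ?r1 \<and> ?l2 \<kappa> c = ?r2 \<and> ?l3 \<kappa> c = ?r3 \<and> ?l4 \<kappa> c = ?r4"
    unfolding s1 s2 by simp
  moreover have "\<kappa> \<noteq> 0" using \<open>1 + m \<noteq> 0\<close> assms(4,5) by (simp add: \<kappa>_def)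
  ultimately show "\<exists>\<kappa> c. \<kappa> \<noteq> 0 \<and> ?l1 \<kappa> c = ?r1 \<and> ?l2 \<kappa> c = ?r2 \<and> ?l3 \<kappa> c = ?r3 \<and> ?l4 \<kappa> c = ?r4"
    by blast
qed

text \<open>Multiplying the equilibrium equations by the squared base replaces the multiplier \<open>lam\<close> by
  \<open>\<kappa> = (e \<bullet> e) lam\<close>.\<close>

lemma relative_equilibrium_trapezoid_iff:
  fixes a :: "real ^ 2"
  assumes fr: "trapezoid_frame e n u" and m: "m \<noteq> 0"
  defines "D \<equiv> diag_ratio e n u" and "L \<equiv> leg_ratio e n u"
  shows "relative_equilibrium (strengths m) (trapezoid_vertex a e n u) \<longleftrightarrow>
    m \<noteq> - 1 \<and> 2 = (1 - m * u) / D + (1 + m * u) / L \<and>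
    2 * m / u = (m * u - 1) / D + (m * u + 1) / L"
proof -
  have "e \<noteq> 0" "n \<noteq> 0" "u > 0" "e \<bullet> n = 0" using fr by (auto simp: trapezoid_frame_def)
  define A where "A = e \<bullet> e"
  have "A > 0" using \<open>e \<noteq> 0\<close> by (simp add: A_def)
  have "L > 0" "D > 0"
    using leg_ratio_pos[OF fr] \<open>u > 0\<close> by (auto simp: D_def L_def diag_ratio_eq)
  let ?v = "trapezoid_vertex a e n u" and ?p = "1 / D" and ?q = "1 / L"
  have rescale: "(\<exists>\<kappa> c. \<kappa> \<noteq> 0 \<and> P \<kappa> c) \<longleftrightarrow> (\<exists>lam c. lam \<noteq> 0 \<and> P (A * lam) c)"
    for P :: "real \<Rightarrow> real ^ 2 \<Rightarrow> bool"
  proof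
    assume "\<exists>\<kappa> c. \<kappa> \<noteq> 0 \<and> P \<kappa> c"
    then obtain \<kappa> c where "\<kappa> \<noteq> 0" "P \<kappa> c" by blast
    then have "\<kappa> / A \<noteq> 0 \<and> P (A * (\<kappa> / A)) c" using \<open>A > 0\<close> by simp
    then show "\<exists>lam c. lam \<noteq> 0 \<and> P (A * lam) c" by blast
  next
    assume "\<exists>lam c. lam \<noteq> 0 \<and> P (A * lam) c"
    then obtain lam c where "lam \<noteq> 0" "P (A * lam) c" by blast
    then show "\<exists>\<kappa> c. \<kappa> \<noteq> 0 \<and> P \<kappa> c"
      using \<open>A > 0\<close> by (intro exI[of _ "A * lam"] exI[of _ c]) simp
  qed
  \<comment> \<open>The sign moves to the right-hand side so that \<open>scale\<close> does not rewrite its own result.\<close>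
  have scale: "- (lam *\<^sub>R y) = z \<longleftrightarrow> (A * lam) *\<^sub>R y = - (A *\<^sub>R z)" for lam and y z :: "real ^ 2"
    using \<open>A > 0\<close> scaleR_cancel_left[of A "- (lam *\<^sub>R y)" z] by (auto simp: minus_equation_iff)
  have negate: "(y = - z) = (- y = z')" if "z = z'" for y z z' :: "real ^ 2"
    using that by (auto simp: minus_equation_iff)
  have edges: "?v 2 - ?v 1 = e" "?v 1 - ?v 2 = - e" "?v 3 - ?v 4 = u *\<^sub>R e" "?v 4 - ?v 3 = - (u *\<^sub>R e)"
    "?v 3 - ?v 1 = n + ((1 + u) / 2) *\<^sub>R e" "?v 1 - ?v 3 = - (n + ((1 + u) / 2) *\<^sub>R e)"
    "?v 4 - ?v 1 = n + ((1 - u) / 2) *\<^sub>R e" "?v 1 - ?v 4 = - (n + ((1 - u) / 2) *\<^sub>R e)"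
    "?v 3 - ?v 2 = n - ((1 - u) / 2) *\<^sub>R e" "?v 2 - ?v 3 = - (n - ((1 - u) / 2) *\<^sub>R e)"
    "?v 4 - ?v 2 = n - ((1 + u) / 2) *\<^sub>R e" "?v 2 - ?v 4 = - (n - ((1 + u) / 2) *\<^sub>R e)"
    by (simp_all add: trapezoid_vertex_simps vec_eq_iff field_simps)
  have weights: "A * (1 / A) = 1" "A * (s / (r * A)) = s * (1 / r)" for s r
    using \<open>A > 0\<close> by simp_all
  have base: "m * u / u\<^sup>2 = m / u" "A \<noteq> 0" using \<open>u > 0\<close> \<open>A > 0\<close> by (simp_all add: power2_eq_square)
  let ?Q = "\<lambda>\<kappa> c.
    - (\<kappa> *\<^sub>R (a - (1 / 2) *\<^sub>R e - c)) = e
      + (m * ?p) *\<^sub>R (n + ((1 + u) / 2) *\<^sub>R e) + (m * ?q) *\<^sub>R (n + ((1 - u) / 2) *\<^sub>R e) \<and>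
    - (\<kappa> *\<^sub>R (a + (1 / 2) *\<^sub>R e - c)) = - e
      + (m * ?q) *\<^sub>R (n - ((1 - u) / 2) *\<^sub>R e) + (m * ?p) *\<^sub>R (n - ((1 + u) / 2) *\<^sub>R e) \<and>
    - (\<kappa> *\<^sub>R (a + n + (u / 2) *\<^sub>R e - c)) = - ((m / u) *\<^sub>R e)
      - ?p *\<^sub>R (n + ((1 + u) / 2) *\<^sub>R e) - ?q *\<^sub>R (n - ((1 - u) / 2) *\<^sub>R e) \<and>
    - (\<kappa> *\<^sub>R (a + n - (u / 2) *\<^sub>R e - c)) = (m / u) *\<^sub>R e
      - ?q *\<^sub>R (n + ((1 - u) / 2) *\<^sub>R e) - ?p *\<^sub>R (n - ((1 + u) / 2) *\<^sub>R e)"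
  have "relative_equilibrium (strengths m) ?v \<longleftrightarrow> (\<exists>lam c. lam \<noteq> 0 \<and> ?Q (A * lam) c)"
    unfolding relative_equilibrium_iff_four_equations[OF m trapezoid_vertex_inj_on[OF fr, of a],
        unfolded trapezoid_distances[OF fr], folded D_def L_def A_def, unfolded edges scale
        scaleR_add_right[of A] scaleR_minus_right scaleR_scaleR weights scaleR_one mult_1]
      trapezoid_vertex_simps
    by (intro iff_exI conj_cong refl negate) (simp_all add: base)
  also have "\<dots> \<longleftrightarrow> (\<exists>\<kappa> c. \<kappa> \<noteq> 0 \<and> ?Q \<kappa> c)"
    using rescale[of ?Q] by (rule sym)
  also have "\<dots> \<longleftrightarrow> m \<noteq> - 1 \<and> 2 = (1 - m * u) * ?p + (1 + m * u) * ?q \<and>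
      2 * (m / u) = (m * u - 1) * ?p + (m * u + 1) * ?q"
    using \<open>e \<noteq> 0\<close> \<open>n \<noteq> 0\<close> \<open>e \<bullet> n = 0\<close> \<open>D > 0\<close> \<open>L > 0\<close>
    by (intro symmetric_vertex_equations_iff) auto
  finally show ?thesis by simp
qed

section \<open>Solving the scalar equations\<close>

text \<open>In terms of \<open>S = D + L\<close> and \<open>u\<^sup>2\<close> the equations become \<open>S (S - 2) = (2 m + 1) u\<^sup>2\<close> and
  \<open>m (S\<^sup>2 - u\<^sup>2) = 2 u\<^sup>2 (m S + 1)\<close>, both linear in \<open>u\<^sup>2\<close>.\<close>

lemma scalar_equations_iff:
  fixes m u D L :: real
  assumes D: "D = L + u" and "L > 0" "u > 0" "m \<noteq> 0"
  shows "m \<noteq> - 1 \<and> 2 = (1 - m * u) / D + (1 + m * u) / L \<and>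
      2 * m / u = (m * u - 1) / D + (m * u + 1) / L
    \<longleftrightarrow> m > 0 \<and> u\<^sup>2 = m * (m + 2) / (2 * m + 1) \<and> D + L = m + 2"
proof -
  have "D > 0" using assms by simp
  define S where "S = D + L"
  have "S > u" using assms by (simp add: S_def)
  have L: "L = (S - u) / 2" and DD: "D = (S + u) / 2" using D by (simp_all add: S_def)
  have "2 = (1 - m * u) / D + (1 + m * u) / L \<longleftrightarrow> 2 * (D * L) = D + L + m * u * (D - L)"
    using \<open>D > 0\<close> \<open>L > 0\<close> by (simp add: field_simps)
  also have "\<dots> \<longleftrightarrow> S * (S - 2) = (2 * m + 1) * u\<^sup>2"
    unfolding L DD by (auto simp add: field_simps power2_eq_square)
  finally have E1: "2 = (1 - m * u) / D + (1 + m * u) / L \<longleftrightarrow> S * (S - 2) = (2 * m + 1) * u\<^sup>2" .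
  have "2 * m / u = (m * u - 1) / D + (m * u + 1) / L
      \<longleftrightarrow> 2 * m * (D * L) = u * (m * u * (D + L) + (D - L))"
    using \<open>D > 0\<close> \<open>L > 0\<close> \<open>u > 0\<close> by (simp add: field_simps)
  also have "\<dots> \<longleftrightarrow> m * (S\<^sup>2 - u\<^sup>2) = 2 * u\<^sup>2 * (m * S + 1)"
    unfolding L DD by (auto simp add: field_simps power2_eq_square)
  finally have E2: "2 * m / u = (m * u - 1) / D + (m * u + 1) / L
      \<longleftrightarrow> m * (S\<^sup>2 - u\<^sup>2) = 2 * u\<^sup>2 * (m * S + 1)" .
  show ?thesis unfolding E1 E2 S_def[symmetric]
  proof
    assume "m \<noteq> - 1 \<and> S * (S - 2) = (2 * m + 1) * u\<^sup>2 \<and>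
      m * (S\<^sup>2 - u\<^sup>2) = 2 * u\<^sup>2 * (m * S + 1)"
    then have "m \<noteq> - 1" and e1: "S * (S - 2) = (2 * m + 1) * u\<^sup>2"
      and e2: "m * (S\<^sup>2 - u\<^sup>2) = 2 * u\<^sup>2 * (m * S + 1)" by auto
    have e3: "u\<^sup>2 * (m * S - m\<^sup>2 + 1) = m * S"
      using e1 e2 by algebra
    have "S * ((S - (m + 2)) * (m * S + 1)) = 0"
      using e1 e3 by algebra
    moreover have "S \<noteq> 0" using \<open>S > u\<close> \<open>u > 0\<close> by simp
    ultimately consider "S = m + 2" | "m * S = - 1" by auto
    then have S: "S = m + 2"
    proof cases
      case 2
      \<comment> \<open>The spurious root is the degenerate trapezoid with legs of length zero.\<close>
      have "m\<^sup>2 * (u\<^sup>2 - S\<^sup>2) = 0" using 2 e3 by algebra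
      then have "u\<^sup>2 = S\<^sup>2" using \<open>m \<noteq> 0\<close> by simp
      moreover have "u\<^sup>2 < S\<^sup>2"
        using \<open>S > u\<close> \<open>u > 0\<close> by (intro power_strict_mono) auto
      ultimately show ?thesis by simp
    qed
    have U: "u\<^sup>2 * (2 * m + 1) = m * (m + 2)"
      using e1 S by algebra
    \<comment> \<open>For negative \<open>m\<close>, positivity of \<open>S\<close> and \<open>u\<^sup>2\<close> leaves \<open>-2 < m < -1/2\<close>; there \<open>u < S\<close> fails,
      since \<open>(m + 2) (2 m + 1) - m = 2 (m + 1)\<^sup>2\<close>.\<close>
    have "m > 0"
    proof (rule ccontr)
      assume "\<not> m > 0"
      then have "m < 0" using \<open>m \<noteq> 0\<close> by simp
      moreover have "m + 2 > 0" using S \<open>S > u\<close> \<open>u > 0\<close> by simp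
      ultimately have "u\<^sup>2 * (2 * m + 1) < 0" unfolding U by (simp add: mult_neg_pos)
      then have neg: "2 * m + 1 < 0" by (simp add: mult_less_0_iff)
      have "u\<^sup>2 < (m + 2)\<^sup>2" using \<open>S > u\<close> \<open>u > 0\<close> S by (intro power_strict_mono) auto
      then have "(m + 2)\<^sup>2 * (2 * m + 1) < u\<^sup>2 * (2 * m + 1)"
        using neg by (simp add: mult_less_cancel_right)
      then have "(m + 2) * (2 * (m + 1)\<^sup>2) < 0"
        unfolding U by (simp add: power2_eq_square algebra_simps)
      moreover have "(m + 2) * (2 * (m + 1)\<^sup>2) \<ge> 0" using \<open>m + 2 > 0\<close> by simp
      ultimately show False by simp
    qed
    then show "m > 0 \<and> u\<^sup>2 = m * (m + 2) / (2 * m + 1) \<and> S = m + 2"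
      using U S by (simp add: field_simps)
  next
    assume a: "m > 0 \<and> u\<^sup>2 = m * (m + 2) / (2 * m + 1) \<and> S = m + 2"
    then have S: "S = m + 2" and "m > 0" and U: "u\<^sup>2 * (2 * m + 1) = m * (m + 2)"
      by (auto simp: field_simps)
    have "S * (S - 2) = (2 * m + 1) * u\<^sup>2" using U S by algebra
    moreover have "m * (S\<^sup>2 - u\<^sup>2) = 2 * u\<^sup>2 * (m * S + 1)" using U S by algebra
    ultimately show "m \<noteq> - 1 \<and> S * (S - 2) = (2 * m + 1) * u\<^sup>2 \<and>
      m * (S\<^sup>2 - u\<^sup>2) = 2 * u\<^sup>2 * (m * S + 1)" using \<open>m > 0\<close> by simp
  qed
qed

section \<open>The family of trapezoid equilibria\<close>

lemma trapezoid_equilibrium_frame_iff: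
  assumes fr: "trapezoid_frame e n u" and "m \<noteq> 0"
  shows "trapezoid_equilibrium m (trapezoid_vertex a e n u) \<longleftrightarrow>
    m > 0 \<and> u\<^sup>2 = m * (m + 2) / (2 * m + 1) \<and> diag_ratio e n u + leg_ratio e n u = m + 2"
proof -
  have "u > 0" using fr by (simp add: trapezoid_frame_def)
  then show ?thesis
    unfolding trapezoid_equilibrium_def relative_equilibrium_trapezoid_iff[OF assms]
      scalar_equations_iff[OF diag_ratio_eq leg_ratio_pos[OF fr] \<open>u > 0\<close> \<open>m \<noteq> 0\<close>]
    using trapezoid_vertex_isosceles_trapezoid[OF fr] by blast
qed

lemma trapezoid_equilibrium_shape:
  assumes "trapezoid_equilibrium m x" "m \<noteq> 0"
  defines "\<alpha> \<equiv> m * (m + 2) / (2 * m + 1)"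
  shows "m > 0" "dist (x 1) (x 2) > 0"
    "(dist (x 3) (x 4) / dist (x 1) (x 2))\<^sup>2 = \<alpha>"
    "(dist (x 1) (x 4) / dist (x 1) (x 2))\<^sup>2 = 1 / 2 * (m + 2 - sqrt \<alpha>)"
    "(dist (x 1) (x 3) / dist (x 1) (x 2))\<^sup>2 = 1 / 2 * (m + 2 + sqrt \<alpha>)"
proof -
  have tr: "isosceles_trapezoid (x 1) (x 2) (x 3) (x 4)"
    using assms(1) by (simp add: trapezoid_equilibrium_def)
  obtain a e n u where fr: "trapezoid_frame e n u"
    and v: "\<forall>i\<in>{1..4}. x i = trapezoid_vertex a e n u i"
    by (rule isosceles_trapezoid_in_frame[OF tr], rule that)
  have "u > 0" "e \<bullet> e > 0" using fr by (auto simp: trapezoid_frame_def)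
  have x: "x 1 = trapezoid_vertex a e n u 1" "x 2 = trapezoid_vertex a e n u 2"
    "x 3 = trapezoid_vertex a e n u 3" "x 4 = trapezoid_vertex a e n u 4" by (auto simp: v)
  have "trapezoid_equilibrium m (trapezoid_vertex a e n u)"
    using assms(1) relative_equilibrium_cong[OF v, of "strengths m"]
    unfolding trapezoid_equilibrium_def x by blast
  then have eq: "m > 0" "u\<^sup>2 = \<alpha>" "diag_ratio e n u + leg_ratio e n u = m + 2"
    using trapezoid_equilibrium_frame_iff[OF fr \<open>m \<noteq> 0\<close>] by (auto simp: \<alpha>_def)
  have u: "u = sqrt \<alpha>" using eq(2) \<open>u > 0\<close> by (metis real_sqrt_unique less_imp_le)
  show "m > 0" by fact
  show "dist (x 1) (x 2) > 0"
    using trapezoid_distances(1)[OF fr, of a] \<open>e \<bullet> e > 0\<close> unfolding x by force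
  show "(dist (x 3) (x 4) / dist (x 1) (x 2))\<^sup>2 = \<alpha>"
    "(dist (x 1) (x 4) / dist (x 1) (x 2))\<^sup>2 = 1 / 2 * (m + 2 - sqrt \<alpha>)"
    "(dist (x 1) (x 3) / dist (x 1) (x 2))\<^sup>2 = 1 / 2 * (m + 2 + sqrt \<alpha>)"
    unfolding power_divide x trapezoid_distances[OF fr]
    using \<open>e \<bullet> e > 0\<close> eq(2,3) by (auto simp: u[symmetric] diag_ratio_eq)
qed

text \<open>One base is fixed on the first coordinate axis with length 1. The height \<open>h\<close> solves
  \<open>D + L = 2 h\<^sup>2 + (1 + u\<^sup>2)/2 = m + 2\<close>.\<close>

lemma trapezoid_equilibrium_family:
  obtains X :: "real \<Rightarrow> nat \<Rightarrow> real ^ 2"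
  where "\<And>i. continuous_on {0<..} (\<lambda>m. X m i)"
    and "\<And>m. m > 0 \<Longrightarrow> trapezoid_equilibrium m (X m)"
proof -
  define u where "u m = sqrt (m * (m + 2) / (2 * m + 1))" for m :: real
  define h where "h m = sqrt (3 / (4 * (2 * m + 1))) * (m + 1)" for m :: real
  define X where "X m = trapezoid_vertex 0 (axis 1 1) (h m *\<^sub>R axis 2 1) (u m)" for m
  have cu: "continuous_on {0<..} u" and ch: "continuous_on {0<..} h"
    unfolding u_def h_def by (intro continuous_intros; force)+
  have "continuous_on {0<..} (\<lambda>m. X m i)" for i
    unfolding X_def trapezoid_vertex_def
    by (cases "i = 1"; cases "i = 2"; cases "i = 3"; auto intro!: continuous_intros cu ch)
  moreover have "trapezoid_equilibrium m (X m)" if "m > 0" for m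
  proof -
    let ?e = "axis 1 1 :: real ^ 2" and ?n = "h m *\<^sub>R axis 2 1 :: real ^ 2"
    have "h m > 0" "u m > 0" and u2: "(u m)\<^sup>2 = m * (m + 2) / (2 * m + 1)"
      using that by (auto simp: h_def u_def)
    have h2: "(h m)\<^sup>2 = 3 * (m + 1)\<^sup>2 / (4 * (2 * m + 1))"
      using that by (simp add: h_def power_mult_distrib)
    have fr: "trapezoid_frame ?e ?n (u m)"
      using \<open>h m > 0\<close> \<open>u m > 0\<close> by (simp add: trapezoid_frame_def inner_axis_axis axis_eq_0_iff)
    have "diag_ratio ?e ?n (u m) + leg_ratio ?e ?n (u m) = 2 * (h m)\<^sup>2 + (1 + (u m)\<^sup>2) / 2"
      by (simp add: diag_ratio_def leg_ratio_def inner_axis_axis power2_eq_square field_simps)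
    also have "\<dots> = m + 2"
      unfolding h2 u2 using that by (simp add: divide_simps) (simp add: power2_eq_square algebra_simps)
    finally show ?thesis
      unfolding X_def using trapezoid_equilibrium_frame_iff[OF fr] that u2 by simp
  qed
  ultimately show thesis using that by blast
qed

text \<open>The converse of Pythagoras gives the right angles.\<close>

lemma is_square_if_sides_diagonals:
  fixes p q r s :: "real ^ 2"
  assumes tr: "isosceles_trapezoid p q r s"
    and "dist r s = dist p q" "dist p s = dist p q"
    and "(dist p r)\<^sup>2 = 2 * (dist p q)\<^sup>2"
  shows "is_square p q r s"
proof -
  have d: "dist p r = dist q s" "dist p s = dist q r"
    using tr by (auto simp: isosceles_trapezoid_def)
  have pyth: "orthogonal (b - a) (c - a)" if "(dist b c)\<^sup>2 = (dist a b)\<^sup>2 + (dist a c)\<^sup>2"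
    for a b c :: "real ^ 2"
    using that unfolding orthogonal_def dist_norm power2_norm_eq_inner
    by (simp add: inner_diff inner_commute)
  have "orthogonal (q - p) (s - p)" "orthogonal (r - q) (p - q)"
    "orthogonal (s - r) (q - r)" "orthogonal (p - s) (r - s)"
    by (rule pyth; use assms(2-4) d in \<open>simp add: dist_commute\<close>)+
  then show ?thesis
    using tr assms(2,3) d by (simp add: is_square_def isosceles_trapezoid_def dist_commute)
qed

theorem theorem7p1:
  shows "(\<exists>X :: real \<Rightarrow> nat \<Rightarrow> real ^ 2.
      (\<forall>i\<in>{1..4}. continuous_on {0<..} (\<lambda>m. X m i)) \<and>
      (\<forall>m>0. trapezoid_equilibrium m (X m))) \<and>
    (\<forall>m. m \<noteq> 0 \<longrightarrow> ((\<exists>x. trapezoid_equilibrium m x) \<longleftrightarrow> m > 0)) \<and>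
    (\<forall>m x. m \<noteq> 0 \<and> trapezoid_equilibrium m x \<longrightarrow>
      (let \<alpha> = m * (m + 2) / (2 * m + 1) in
        (dist (x 3) (x 4) / dist (x 1) (x 2))\<^sup>2 = \<alpha> \<and>
        (dist (x 1) (x 4) / dist (x 1) (x 2))\<^sup>2 = 1 / 2 * (m + 2 - sqrt \<alpha>) \<and>
        (dist (x 1) (x 3) / dist (x 1) (x 2))\<^sup>2 = 1 / 2 * (m + 2 + sqrt \<alpha>))) \<and>
    (\<forall>x. trapezoid_equilibrium 1 x \<longrightarrow> is_square (x 1) (x 2) (x 3) (x 4)) \<and>
    (\<forall>m x. m \<noteq> 0 \<and> trapezoid_equilibrium m x \<longrightarrow>
      (m > 1 \<longrightarrow> dist (x 3) (x 4) > dist (x 1) (x 2)) \<and>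
      (m < 1 \<longrightarrow> dist (x 1) (x 2) > dist (x 3) (x 4)))"
proof (intro conjI)
  obtain X :: "real \<Rightarrow> nat \<Rightarrow> real ^ 2"
    where X: "\<And>i. continuous_on {0<..} (\<lambda>m. X m i)"
      "\<And>m. m > 0 \<Longrightarrow> trapezoid_equilibrium m (X m)"
    using trapezoid_equilibrium_family by blast
  show "\<exists>X :: real \<Rightarrow> nat \<Rightarrow> real ^ 2. (\<forall>i\<in>{1..4}. continuous_on {0<..} (\<lambda>m. X m i)) \<and>
      (\<forall>m>0. trapezoid_equilibrium m (X m))"
    using X by blast
  show "\<forall>m. m \<noteq> 0 \<longrightarrow> ((\<exists>x. trapezoid_equilibrium m x) \<longleftrightarrow> m > 0)"
    using X(2) trapezoid_equilibrium_shape(1) by blast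
  show "\<forall>m x. m \<noteq> 0 \<and> trapezoid_equilibrium m x \<longrightarrow>
      (let \<alpha> = m * (m + 2) / (2 * m + 1) in
        (dist (x 3) (x 4) / dist (x 1) (x 2))\<^sup>2 = \<alpha> \<and>
        (dist (x 1) (x 4) / dist (x 1) (x 2))\<^sup>2 = 1 / 2 * (m + 2 - sqrt \<alpha>) \<and>
        (dist (x 1) (x 3) / dist (x 1) (x 2))\<^sup>2 = 1 / 2 * (m + 2 + sqrt \<alpha>))"
    unfolding Let_def using trapezoid_equilibrium_shape(3-5) by blast
  show "\<forall>x. trapezoid_equilibrium 1 x \<longrightarrow> is_square (x 1) (x 2) (x 3) (x 4)"
  proof (intro allI impI)
    fix x assume x: "trapezoid_equilibrium 1 x"
    note sh = trapezoid_equilibrium_shape[OF x]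
    have d: "(dist (x 3) (x 4))\<^sup>2 = (dist (x 1) (x 2))\<^sup>2" "(dist (x 1) (x 4))\<^sup>2 = (dist (x 1) (x 2))\<^sup>2"
      "(dist (x 1) (x 3))\<^sup>2 = 2 * (dist (x 1) (x 2))\<^sup>2"
      using sh(2-5) by (simp_all add: power_divide divide_eq_eq)
    have "dist (x 3) (x 4) = dist (x 1) (x 2)" "dist (x 1) (x 4) = dist (x 1) (x 2)"
      using d(1,2) by simp_all
    then show "is_square (x 1) (x 2) (x 3) (x 4)"
      using x d(3) by (intro is_square_if_sides_diagonals) (auto simp: trapezoid_equilibrium_def)
  qed
  show "\<forall>m x. m \<noteq> 0 \<and> trapezoid_equilibrium m x \<longrightarrow>
      (m > 1 \<longrightarrow> dist (x 3) (x 4) > dist (x 1) (x 2)) \<and>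
      (m < 1 \<longrightarrow> dist (x 1) (x 2) > dist (x 3) (x 4))"
  proof (intro allI impI; elim conjE)
    fix m x assume "m \<noteq> 0" and x: "trapezoid_equilibrium m x"
    note sh = trapezoid_equilibrium_shape[OF x \<open>m \<noteq> 0\<close>]
    let ?\<rho> = "dist (x 3) (x 4) / dist (x 1) (x 2)"
    have "?\<rho>\<^sup>2 - 1 = (m - 1) * ((m + 1) / (2 * m + 1))"
      using sh(1) unfolding sh(3) by (simp add: field_simps power2_eq_square)
    moreover have "(m + 1) / (2 * m + 1) > 0" using sh(1) by simp
    ultimately have "m > 1 \<Longrightarrow> ?\<rho>\<^sup>2 > 1\<^sup>2" "m < 1 \<Longrightarrow> ?\<rho>\<^sup>2 < 1\<^sup>2"
      by (smt (verit) mult_pos_pos mult_neg_pos one_power2)+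
    then have "m > 1 \<Longrightarrow> ?\<rho> > 1" "m < 1 \<Longrightarrow> ?\<rho> < 1"
      by (auto intro: power2_less_imp_less)
    then show "(m > 1 \<longrightarrow> dist (x 3) (x 4) > dist (x 1) (x 2)) \<and>
      (m < 1 \<longrightarrow> dist (x 1) (x 2) > dist (x 3) (x 4))"
      using sh(2) by (simp add: field_simps)
  qed
qed

end
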